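(* Let $E$ be a left $A$-module with a left covariant derivative $\nabla_E:E\to\Omega^1A\otimes_A E$, with curvature $R_E=(\mathrm{d}\otimes\mathrm{id}_E-\mathrm{id}\wedge\nabla_E)\nabla_E:E\to\Omega^2A\otimes_A E$. Let $$\mathcal R=\sum_i \mathrm{d}\xi_i\otimes u_i-\sum_{i,j}\xi_i\wedge\xi_j\otimes (u_j\bullet u_i)\in\Omega^2A\otimes_A\mathcal T\mathrm{Vec}A_\bullet .$$ Let the $\mathcal T\mathrm{Vec}A_\bullet$ component of $\mathcal R$ act on $E$, i.e. put $(\omega\otimes\underline v)\triangleright e=\omega\otimes(\underline v\triangleright e)\in\Omega^2A\otimes_AE$, extended additively. Then $\mathcal R\triangleright e=R_E(e)$ for all $e\in E$.
   Context: Setting. $A$ is a unital algebra over $\mathbb C$ and $(\Omega A=\oplus_{n\ge0}\Omega^nA,\mathrm d,\wedge)$ is a differential graded algebra with $\Omega^0A=A$, $\mathrm d^2=0$, graded Leibniz rule, generated over $A$ by $\Omega^1A$, with $\Omega^1A=A.\mathrm dA$ (no graded commutativity). $\Omega^1A$ is finitely generated projective as a right $A$-module; $\mathrm{Vec}A=\mathrm{Hom}_A(\Omega^1A,A)$ (right module maps), a bimodule by $(a.v)(\xi)=a\,v(\xi)$, $(v.a)(\xi)=v(a\xi)$; $\mathrm{ev}:\mathrm{Vec}A\otimes_A\Omega^1A\to A$ is evaluation and $\sum_i\xi_i\otimes u_i\in\Omega^1A\otimes_A\mathrm{Vec}A$ is the dual basis ($\xi=\sum_i\xi_i.u_i(\xi)$).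 $\Omega^{\otimes n}A$, $\mathrm{Vec}^{\otimes n}A$ are $n$-fold tensor powers over $A$ (equal to $A$ for $n=0$). $\mathrm{ev}^{\langle n\rangle}:\mathrm{Vec}^{\otimes n}A\otimes_A\Omega^{\otimes n}A\to A$ is nested evaluation: $\mathrm{ev}^{\langle1\rangle}=\mathrm{ev}$, $\mathrm{ev}^{\langle n+1\rangle}=\mathrm{ev}(\mathrm{id}\otimes\mathrm{ev}^{\langle n\rangle}\otimes\mathrm{id})$. Covariant derivatives. A left covariant derivative satisfies $\nabla_E(ae)=\mathrm da\otimes e+a\nabla_E(e)$. A right bimodule covariant derivative $(\square,\sigma^{-1})$ on $\Omega^1A$ is fixed: $\square:\Omega^1A\to\Omega^1A\otimes_A\Omega^1A$ with $\square(\xi a)=\square(\xi)a+\xi\otimes\mathrm da$ and $\square(a\xi)=a\square(\xi)+\sigma^{-1}(\mathrm da\otimes\xi)$, where $\sigma^{-1}:\Omega^{\otimes2}A\to\Omega^{\otimes2}A$ is a bimodule map (not assumed invertible; the notation is only a convention). Extend by $\square^{\langle0\rangle}=\mathrm d$, $\square^{\langle1\rangle}=\square$, $\square^{\langle n+1\rangle}=\mathrm{id}^{\otimes n}\otimes\square+(\mathrm{id}^{\otimes n}\otimes\sigma^{-1})(\square^{\langle n\rangle}\otimes\mathrm{id}):\Omega^{\otimes n+1}A\to\Omega^{\otimes n+2}A$. The dual left bimodule covariant derivative $\square:\mathrm{Vec}A\to\Omega^1A\otimes_A\mathrm{Vec}A$ is determined by $\mathrm d\circ\mathrm{ev}=(\mathrm{id}\otimes\mathrm{ev})(\square\otimes\mathrm{id})+(\mathrm{ev}\otimes\mathrm{id})(\mathrm{id}\otimes\square)$,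 with $\sigma=(\mathrm{ev}\otimes\mathrm{id}\otimes\mathrm{id})(\mathrm{id}\otimes\sigma^{-1}\otimes\mathrm{id})(\mathrm{id}\otimes\mathrm{id}\otimes\mathrm{coev}(1)):\mathrm{Vec}A\otimes_A\Omega^1A\to\Omega^1A\otimes_A\mathrm{Vec}A$, $\mathrm{coev}(1)=\sum_i\xi_i\otimes u_i$. It extends to $\square^{\langle n\rangle}:\mathrm{Vec}^{\otimes n}A\to\Omega^1A\otimes_A\mathrm{Vec}^{\otimes n}A$ by $\square^{\langle0\rangle}=\mathrm d$, $\square^{\langle n+1\rangle}=\square\otimes\mathrm{id}^{\otimes n}+(\sigma\otimes\mathrm{id}^{\otimes n})(\mathrm{id}\otimes\square^{\langle n\rangle})$. Product and action. $\mathcal T\mathrm{Vec}A=\bigoplus_{n\ge0}\mathrm{Vec}^{\otimes n}A$ carries an associative unital product $\bullet$ determined by $a\bullet\underline w=a.\underline w$, $u\bullet\underline w=u\otimes\underline w+(\mathrm{ev}\otimes\mathrm{id}^{\otimes m})(u\otimes\square^{\langle m\rangle}\underline w)$ and $(u\otimes\underline v)\bullet\underline w=u\bullet(\underline v\bullet\underline w)-\big((\mathrm{ev}\otimes\mathrm{id}^{\otimes n})(u\otimes\square^{\langle n\rangle}\underline v)\big)\bullet\underline w$, for $a\in A$, $u\in\mathrm{Vec}A$, $\underline v\in\mathrm{Vec}^{\otimes n}A$, $\underline w\in\mathrm{Vec}^{\otimes m}A$. $\mathcal T\mathrm{Vec}A_\bullet$ denotes this algebra, with left $A$-action the usual one and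 right $A$-action $\bullet$. It acts on $(E,\nabla_E)$ by $\underline v\triangleright e=(\mathrm{ev}^{\langle n\rangle}\otimes\mathrm{id}_E)(\underline v\otimes\nabla_E^{(n)}e)$ for $\underline v\in\mathrm{Vec}^{\otimes n}A$, where $\nabla_E^{(1)}=\nabla_E$, $\nabla_E^{(n+1)}=(\square^{\langle n\rangle}\otimes\mathrm{id}_E+\mathrm{id}^{\otimes n}\otimes\nabla_E)\nabla_E^{(n)}$ (and $a\triangleright e=a.e$ for $n=0$). *)

theory Defs
  imports Complex_Main "HOL-Library.Poly_Mapping"
begin

section \<open>Differential graded algebras, vector fields and left modules\<close>

text \<open>
  The type \<open>'w\<close> is the whole algebra \<open>\<Omega>A\<close>, with the wedge product as ring multiplication;
  \<open>A\<close> itself is the subring \<open>Omega G 0\<close>. The type \<open>'e\<close> is the left \<open>A\<close>-module \<open>E\<close>.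
\<close>

record 'w dga =
  cscale :: "complex \<Rightarrow> 'w \<Rightarrow> 'w"
  Omega :: "nat \<Rightarrow> 'w set"
  dif :: "'w \<Rightarrow> 'w"

record ('w, 'e) dga_module = "'w dga" +
  smul :: "'w \<Rightarrow> 'e \<Rightarrow> 'e"

locale dg_algebra =
  fixes G :: "('w::ring_1, 'm) dga_scheme"
  assumes vector_space: "vector_space (cscale G)"
    and scale_mult_left: "cscale G c x * y = cscale G c (x * y)"
    and scale_mult_right: "x * cscale G c y = cscale G c (x * y)"
    and Omega_subspace: "module.subspace (cscale G) (Omega G n)"
    and Omega_direct_sum:
      "\<exists>!f. (\<forall>n. f n \<in> Omega G n) \<and> finite {n. f n \<noteq> 0} \<and> x = (\<Sum>n | f n \<noteq> 0. f n)"
    and Omega_one: "1 \<in> Omega G 0"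
    and Omega_mult: "\<lbrakk>x \<in> Omega G m; y \<in> Omega G n\<rbrakk> \<Longrightarrow> x * y \<in> Omega G (m + n)"
    and dif_linear: "Vector_Spaces.linear (cscale G) (cscale G) (dif G)"
    and dif_degree: "x \<in> Omega G n \<Longrightarrow> dif G x \<in> Omega G (Suc n)"
    and dif_dif: "dif G (dif G x) = 0"
    and dif_leibniz: "x \<in> Omega G n \<Longrightarrow> dif G (x * y) = dif G x * y + (-1) ^ n * x * dif G y"
    and generated: "\<lbrakk>Omega G 0 \<subseteq> S; Omega G 1 \<subseteq> S;
        \<And>x y. \<lbrakk>x \<in> S; y \<in> S\<rbrakk> \<Longrightarrow> x - y \<in> S \<and> x * y \<in> S\<rbrakk> \<Longrightarrow> S = UNIV"
    and Omega_1_eq: "Omega G 1 =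
        {\<Sum>i<k. a i * dif G (b i) | (k::nat) a b. \<forall>i<k. a i \<in> Omega G 0 \<and> b i \<in> Omega G 0}"

text \<open>Right \<open>A\<close>-module maps \<open>\<Omega>\<^sup>1A \<rightarrow> A\<close>, extended by 0 outside \<open>\<Omega>\<^sup>1A\<close> so that equality of
  functions is equality of module maps.\<close>

definition Vec :: "('w::ring_1, 'm) dga_scheme \<Rightarrow> ('w \<Rightarrow> 'w) set" where
  "Vec G = {v. (\<forall>\<xi>\<in>Omega G 1. v \<xi> \<in> Omega G 0)
     \<and> (\<forall>\<xi>\<in>Omega G 1. \<forall>\<eta>\<in>Omega G 1. v (\<xi> + \<eta>) = v \<xi> + v \<eta>)
     \<and> (\<forall>\<xi>\<in>Omega G 1. \<forall>a\<in>Omega G 0. v (\<xi> * a) = v \<xi> * a)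
     \<and> (\<forall>\<xi>. \<xi> \<notin> Omega G 1 \<longrightarrow> v \<xi> = 0)}"

section \<open>Tensor products over \<open>A\<close>\<close>

text \<open>
  A tensor is represented by a formal integer combination of words; the word \<open>[x\<^sub>1, \<dots>, x\<^sub>n]\<close>
  stands for \<open>x\<^sub>1 \<otimes> \<dots> \<otimes> x\<^sub>n\<close>, with letters from \<open>\<Omega>\<^sup>kA\<close>, \<open>Vec A\<close> or \<open>E\<close>. The tensor product
  \<open>M\<^sub>1 \<otimes>\<^sub>A \<dots> \<otimes>\<^sub>A M\<^sub>n\<close> is \<open>tensors [M\<^sub>1, \<dots>, M\<^sub>n]\<close> modulo the congruence \<open>\<approx>\<close> generated by
  additivity in each letter, \<open>A\<close>-balancing, and absorption of scalar letters \<open>a \<in> A\<close> into their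
  neighbours, i.e. the identifications \<open>A \<otimes>\<^sub>A M = M = M \<otimes>\<^sub>A A\<close>. All words occur in a single type,
  but the congruence does not relate components whose shapes differ after removing scalar letters.
  The empty word is the unit of \<open>A\<close>.

  A map into a tensor product is given by a choice of representatives, so identities between
  its values are stated with \<open>\<approx>\<close>. Maps out of formal sums are additive extensions (\<^const>\<open>frag_extend\<close>)
  of maps on words. Sums such as \<open>\<box> \<otimes> id + id \<otimes> \<nabla>\<close>, whose individual terms are not defined on \<open>\<otimes>\<^sub>A\<close>,
  therefore make sense on representatives.
\<close>

datatype ('w, 'e) letter = Form (form: 'w) | Vect (vect: "'w \<Rightarrow> 'w") | Elt (elt: 'e)

type_synonym ('w, 'e) tensor = "('w, 'e) letter list \<Rightarrow>\<^sub>0 int"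

definition forms :: "('w, 'm) dga_scheme \<Rightarrow> nat \<Rightarrow> ('w, 'e) letter set" where
  "forms G n = Form ` Omega G n"

definition vecs :: "('w::ring_1, 'm) dga_scheme \<Rightarrow> ('w, 'e) letter set" where
  "vecs G = Vect ` Vec G"

definition elts :: "('w, 'e) letter set" where
  "elts = range Elt"

definition tensors :: "('w, 'e) letter set list \<Rightarrow> ('w, 'e) tensor set" where
  "tensors Ms = {x. Poly_Mapping.keys x \<subseteq> listset Ms}"

definition tmult :: "('w, 'e) tensor \<Rightarrow> ('w, 'e) tensor \<Rightarrow> ('w, 'e) tensor" (infixr "\<otimes>" 75) where
  "x \<otimes> y = frag_extend (\<lambda>p. frag_extend (\<lambda>q. frag_of (p @ q)) y) x"

primrec lact :: "('w::ring_1, 'e, 'm) dga_module_scheme \<Rightarrow> 'w \<Rightarrow> ('w, 'e) letter \<Rightarrow> ('w, 'e) letter"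
  where
    "lact G a (Form w) = Form (a * w)"
  | "lact G a (Vect v) = Vect (\<lambda>\<xi>. a * v \<xi>)"
  | "lact G a (Elt e) = Elt (smul G a e)"

text \<open>\<open>E\<close> has no right action; the value on \<^const>\<open>Elt\<close> is a dummy that is never used.\<close>

primrec ract :: "('w::ring_1, 'e, 'm) dga_module_scheme \<Rightarrow> ('w, 'e) letter \<Rightarrow> 'w \<Rightarrow> ('w, 'e) letter"
  where
    "ract G (Form w) a = Form (w * a)"
  | "ract G (Vect v) a = Vect (\<lambda>\<xi>. if \<xi> \<in> Omega G 1 then v (a * \<xi>) else 0)"
  | "ract G (Elt e) a = Elt e"

definition bimodule_letters :: "('w::ring_1, 'm) dga_scheme \<Rightarrow> ('w, 'e) letter set" where
  "bimodule_letters G = (\<Union>n. forms G n) \<union> vecs G"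

inductive_set tensor_relations ::
    "('w::ring_1, 'e::ab_group_add, 'm) dga_module_scheme \<Rightarrow> ('w, 'e) tensor set"
  for G where
    zero: "0 \<in> tensor_relations G"
  | minus: "\<lbrakk>x \<in> tensor_relations G; y \<in> tensor_relations G\<rbrakk> \<Longrightarrow> x - y \<in> tensor_relations G"
  | add_form: "\<lbrakk>x \<in> Omega G n; y \<in> Omega G n\<rbrakk> \<Longrightarrow>
      frag_of (p @ [Form (x + y)] @ q) - frag_of (p @ [Form x] @ q) - frag_of (p @ [Form y] @ q)
        \<in> tensor_relations G"
  | add_vect: "\<lbrakk>u \<in> Vec G; v \<in> Vec G\<rbrakk> \<Longrightarrow>
      frag_of (p @ [Vect (\<lambda>\<xi>. u \<xi> + v \<xi>)] @ q) - frag_of (p @ [Vect u] @ q)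
        - frag_of (p @ [Vect v] @ q) \<in> tensor_relations G"
  | add_elt: "frag_of (p @ [Elt (e + f)] @ q) - frag_of (p @ [Elt e] @ q)
        - frag_of (p @ [Elt f] @ q) \<in> tensor_relations G"
  | balanced: "\<lbrakk>x \<in> bimodule_letters G; a \<in> Omega G 0; y \<in> bimodule_letters G \<union> elts\<rbrakk> \<Longrightarrow>
      frag_of (p @ [ract G x a, y] @ q) - frag_of (p @ [x, lact G a y] @ q) \<in> tensor_relations G"
  | absorb_left: "\<lbrakk>a \<in> Omega G 0; y \<in> bimodule_letters G \<union> elts\<rbrakk> \<Longrightarrow>
      frag_of (p @ [Form a, y] @ q) - frag_of (p @ [lact G a y] @ q) \<in> tensor_relations G"
  | absorb_right: "\<lbrakk>x \<in> bimodule_letters G; a \<in> Omega G 0\<rbrakk> \<Longrightarrow>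
      frag_of (p @ [x, Form a] @ q) - frag_of (p @ [ract G x a] @ q) \<in> tensor_relations G"
  | unit: "frag_of [Form 1] - frag_of [] \<in> tensor_relations G"

definition teq :: "('w::ring_1, 'e::ab_group_add, 'm) dga_module_scheme \<Rightarrow>
    ('w, 'e) tensor \<Rightarrow> ('w, 'e) tensor \<Rightarrow> bool" ("(_ \<approx>\<index> _)" [51, 51] 50) where
  "x \<approx>\<^bsub>G\<^esub> y \<longleftrightarrow> x - y \<in> tensor_relations G"

primrec lmul_word :: "('w::ring_1, 'e, 'm) dga_module_scheme \<Rightarrow> 'w \<Rightarrow>
    ('w, 'e) letter list \<Rightarrow> ('w, 'e) letter list" where
    "lmul_word G a [] = [Form a]"
  | "lmul_word G a (x # p) = lact G a x # p"

definition lmul :: "('w::ring_1, 'e, 'm) dga_module_scheme \<Rightarrow> 'w \<Rightarrow>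
    ('w, 'e) tensor \<Rightarrow> ('w, 'e) tensor" where
  "lmul G a x = frag_extend (\<lambda>p. frag_of (lmul_word G a p)) x"

text \<open>\<open>(ev \<otimes> id)(u \<otimes> x)\<close> for \<open>x\<close> a combination of words starting with a 1-form.\<close>

definition ev_left :: "('w::ring_1, 'e, 'm) dga_module_scheme \<Rightarrow> ('w \<Rightarrow> 'w) \<Rightarrow>
    ('w, 'e) tensor \<Rightarrow> ('w, 'e) tensor" where
  "ev_left G u x = frag_extend (\<lambda>p. frag_of (lmul_word G (u (form (hd p))) (tl p))) x"

section \<open>Covariant derivatives\<close>

text \<open>
  \<open>coframe i\<close> and \<open>frame i\<close>, \<open>i < rank\<close>, are \<open>\<xi>\<^sub>i\<close> and \<open>u\<^sub>i\<close>; \<open>fbox\<close> is \<open>\<box>\<close> on \<open>\<Omega>\<^sup>1A\<close>; \<open>sinv \<xi> \<eta>\<close> is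
  \<open>\<sigma>\<^sup>-\<^sup>1(\<xi> \<otimes> \<eta>)\<close>; \<open>vbox\<close> is the dual \<open>\<box>\<close> on \<open>Vec A\<close>; \<open>nabla\<close> is \<open>\<nabla>\<^sub>E\<close>.
\<close>

record ('w, 'e) connection = "('w, 'e) dga_module" +
  rank :: nat
  coframe :: "nat \<Rightarrow> 'w"
  frame :: "nat \<Rightarrow> 'w \<Rightarrow> 'w"
  fbox :: "'w \<Rightarrow> ('w, 'e) tensor"
  sinv :: "'w \<Rightarrow> 'w \<Rightarrow> ('w, 'e) tensor"
  vbox :: "('w \<Rightarrow> 'w) \<Rightarrow> ('w, 'e) tensor"
  nabla :: "'e \<Rightarrow> ('w, 'e) tensor"

locale left_module = dg_algebra G
  for G :: "('w::ring_1, 'e::ab_group_add, 'm) dga_module_scheme" +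
  assumes smul_add_right: "a \<in> Omega G 0 \<Longrightarrow> smul G a (e + f) = smul G a e + smul G a f"
    and smul_add_left:
      "\<lbrakk>a \<in> Omega G 0; b \<in> Omega G 0\<rbrakk> \<Longrightarrow> smul G (a + b) e = smul G a e + smul G b e"
    and smul_assoc: "\<lbrakk>a \<in> Omega G 0; b \<in> Omega G 0\<rbrakk> \<Longrightarrow> smul G (a * b) e = smul G a (smul G b e)"
    and smul_one: "smul G 1 e = e"

locale dual_basis = dg_algebra G
  for G :: "('w::ring_1, 'e::ab_group_add, 'm) connection_scheme" +
  assumes coframe_in: "i < rank G \<Longrightarrow> coframe G i \<in> Omega G 1"
    and frame_in: "i < rank G \<Longrightarrow> frame G i \<in> Vec G"
    and dual_basis: "\<xi> \<in> Omega G 1 \<Longrightarrow> \<xi> = (\<Sum>i<rank G. coframe G i * frame G i \<xi>)"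

text \<open>A right bimodule covariant derivative. By the universal property, the bimodule map
  \<open>\<sigma>\<^sup>-\<^sup>1\<close> is given on pairs as a biadditive balanced map.\<close>

locale right_bimodule_connection = dg_algebra G
  for G :: "('w::ring_1, 'e::ab_group_add, 'm) connection_scheme" +
  assumes fbox_in: "\<xi> \<in> Omega G 1 \<Longrightarrow> fbox G \<xi> \<in> tensors [forms G 1, forms G 1]"
    and fbox_add: "\<lbrakk>\<xi> \<in> Omega G 1; \<eta> \<in> Omega G 1\<rbrakk> \<Longrightarrow> fbox G (\<xi> + \<eta>) \<approx>\<^bsub>G\<^esub> fbox G \<xi> + fbox G \<eta>"
    and fbox_right: "\<lbrakk>\<xi> \<in> Omega G 1; a \<in> Omega G 0\<rbrakk> \<Longrightarrow>
      fbox G (\<xi> * a) \<approx>\<^bsub>G\<^esub> fbox G \<xi> \<otimes> frag_of [Form a] + frag_of [Form \<xi>, Form (dif G a)]"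
    and fbox_left: "\<lbrakk>\<xi> \<in> Omega G 1; a \<in> Omega G 0\<rbrakk> \<Longrightarrow>
      fbox G (a * \<xi>) \<approx>\<^bsub>G\<^esub> lmul G a (fbox G \<xi>) + sinv G (dif G a) \<xi>"
    and sinv_in: "\<lbrakk>\<xi> \<in> Omega G 1; \<eta> \<in> Omega G 1\<rbrakk> \<Longrightarrow> sinv G \<xi> \<eta> \<in> tensors [forms G 1, forms G 1]"
    and sinv_add_left: "\<lbrakk>\<xi> \<in> Omega G 1; \<xi>' \<in> Omega G 1; \<eta> \<in> Omega G 1\<rbrakk> \<Longrightarrow>
      sinv G (\<xi> + \<xi>') \<eta> \<approx>\<^bsub>G\<^esub> sinv G \<xi> \<eta> + sinv G \<xi>' \<eta>"
    and sinv_add_right: "\<lbrakk>\<xi> \<in> Omega G 1; \<eta> \<in> Omega G 1; \<eta>' \<in> Omega G 1\<rbrakk> \<Longrightarrow>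
      sinv G \<xi> (\<eta> + \<eta>') \<approx>\<^bsub>G\<^esub> sinv G \<xi> \<eta> + sinv G \<xi> \<eta>'"
    and sinv_balanced: "\<lbrakk>\<xi> \<in> Omega G 1; \<eta> \<in> Omega G 1; a \<in> Omega G 0\<rbrakk> \<Longrightarrow>
      sinv G (\<xi> * a) \<eta> \<approx>\<^bsub>G\<^esub> sinv G \<xi> (a * \<eta>)"
    and sinv_left: "\<lbrakk>\<xi> \<in> Omega G 1; \<eta> \<in> Omega G 1; a \<in> Omega G 0\<rbrakk> \<Longrightarrow>
      sinv G (a * \<xi>) \<eta> \<approx>\<^bsub>G\<^esub> lmul G a (sinv G \<xi> \<eta>)"
    and sinv_right: "\<lbrakk>\<xi> \<in> Omega G 1; \<eta> \<in> Omega G 1; a \<in> Omega G 0\<rbrakk> \<Longrightarrow>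
      sinv G \<xi> (\<eta> * a) \<approx>\<^bsub>G\<^esub> sinv G \<xi> \<eta> \<otimes> frag_of [Form a]"

text \<open>The equation \<open>d \<circ> ev = (id \<otimes> ev)(\<box> \<otimes> id) + (ev \<otimes> id)(id \<otimes> \<box>)\<close> on \<open>u \<otimes> \<xi>\<close>; together with
  the dual basis it determines \<open>\<box>\<close> on \<open>Vec A\<close>.\<close>

locale dual_connection = dual_basis G + right_bimodule_connection G
  for G :: "('w::ring_1, 'e::ab_group_add, 'm) connection_scheme" +
  assumes vbox_in: "u \<in> Vec G \<Longrightarrow> vbox G u \<in> tensors [forms G 1, vecs G]"
    and vbox_dual: "\<lbrakk>u \<in> Vec G; \<xi> \<in> Omega G 1\<rbrakk> \<Longrightarrow>
      frag_of [Form (dif G (u \<xi>))] \<approx>\<^bsub>G\<^esub>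
        frag_extend (\<lambda>p. frag_of [Form (form (p ! 0) * vect (p ! 1) \<xi>)]) (vbox G u)
        + ev_left G u (fbox G \<xi>)"

locale left_connection = left_module G + dual_connection G
  for G :: "('w::ring_1, 'e::ab_group_add, 'm) connection_scheme" +
  assumes nabla_in: "nabla G e \<in> tensors [forms G 1, elts]"
    and nabla_add: "nabla G (e + f) \<approx>\<^bsub>G\<^esub> nabla G e + nabla G f"
    and nabla_left: "a \<in> Omega G 0 \<Longrightarrow>
      nabla G (smul G a e) \<approx>\<^bsub>G\<^esub> frag_of [Form (dif G a), Elt e] + lmul G a (nabla G e)"

section \<open>Extension to tensor powers\<close>

definition sigma :: "('w::ring_1, 'e, 'm) connection_scheme \<Rightarrow> ('w \<Rightarrow> 'w) \<Rightarrow> 'w \<Rightarrow> ('w, 'e) tensor"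
  where
  "sigma G u \<omega> = (\<Sum>i<rank G. ev_left G u (sinv G \<omega> (coframe G i) \<otimes> frag_of [Vect (frame G i)]))"

text \<open>\<open>\<box>\<^sup>\<langle>\<^sup>n\<^sup>\<rangle>\<close> on words of length \<open>n\<close> in \<open>\<Omega>\<^sup>1A\<close>; for \<open>n = 0\<close> it is \<open>d\<close> at the empty word, i.e. \<open>d 1 = 0\<close>.\<close>

primrec fbox_pow :: "('w::ring_1, 'e, 'm) connection_scheme \<Rightarrow> nat \<Rightarrow>
    ('w, 'e) letter list \<Rightarrow> ('w, 'e) tensor" where
    "fbox_pow G 0 p = 0"
  | "fbox_pow G (Suc n) p = frag_of (butlast p) \<otimes> fbox G (form (last p))
       + frag_extend (\<lambda>r. frag_of (butlast r) \<otimes> sinv G (form (last r)) (form (last p)))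
           (fbox_pow G n (butlast p))"

text \<open>
  \<open>\<box>\<^sup>\<langle>\<^sup>n\<^sup>\<rangle>\<close> on words with \<open>n\<close> vector letters. Such words may contain scalar letters (as \<open>[Form a]\<close> for
  \<open>a \<in> A\<close>, or \<open>u \<otimes> b\<close> for \<open>u \<in> Vec A\<close>, \<open>b \<in> A\<close>), handled by \<open>\<box>(a.w) = da \<otimes> w + a.\<box>w\<close>. For the word
  \<open>[Form a]\<close> this gives \<open>\<box>\<^sup>\<langle>\<^sup>0\<^sup>\<rangle> a = da\<close>.
\<close>

fun vbox_pow :: "('w::ring_1, 'e, 'm) connection_scheme \<Rightarrow>
    ('w, 'e) letter list \<Rightarrow> ('w, 'e) tensor" where
    "vbox_pow G [] = 0"
  | "vbox_pow G (Form a # p) = frag_of (Form (dif G a) # p) + lmul G a (vbox_pow G p)"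
  | "vbox_pow G (Vect u # p) = vbox G u \<otimes> frag_of p
       + frag_extend (\<lambda>r. sigma G u (form (hd r)) \<otimes> frag_of (tl r)) (vbox_pow G p)"
  | "vbox_pow G (Elt e # p) = 0"

section \<open>The product on \<open>\<T>Vec A\<close> and its action on \<open>E\<close>\<close>

definition vec_degree :: "('w, 'e) letter list \<Rightarrow> nat" where
  "vec_degree p = length (filter is_Vect p)"

text \<open>\<open>u \<bullet> w\<close> for \<open>u \<in> Vec A\<close>.\<close>

definition vprod :: "('w::ring_1, 'e, 'm) connection_scheme \<Rightarrow> ('w \<Rightarrow> 'w) \<Rightarrow>
    ('w, 'e) tensor \<Rightarrow> ('w, 'e) tensor" where
  "vprod G u w = frag_of [Vect u] \<otimes> w + ev_left G u (frag_extend (vbox_pow G) w)"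

text \<open>
  \<open>p \<bullet> w\<close> for a word \<open>p\<close>. The first argument is the degree \<open>n\<close> of \<open>p\<close>, on which the recursion
  \<open>(u \<otimes> v) \<bullet> w = u \<bullet> (v \<bullet> w) - ((ev \<otimes> id)(u \<otimes> \<box>v)) \<bullet> w\<close> terminates: \<open>v\<close> and \<open>(ev \<otimes> id)(u \<otimes> \<box>v)\<close> have
  degree \<open>n - 1\<close>. For \<open>v = []\<close>, i.e. \<open>v = 1 \<in> A\<close>, the subtracted term vanishes and the
  result is \<open>u \<bullet> w\<close>. The clause for degree 0 and a vector letter is unreachable.
\<close>

fun word_prod :: "('w::ring_1, 'e, 'm) connection_scheme \<Rightarrow> nat \<Rightarrow>
    ('w, 'e) letter list \<Rightarrow> ('w, 'e) tensor \<Rightarrow> ('w, 'e) tensor" where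
    "word_prod G n [] w = w"
  | "word_prod G n (Form a # p) w = lmul G a (word_prod G n p w)"
  | "word_prod G (Suc n) (Vect u # p) w = vprod G u (word_prod G n p w)
       - frag_extend (\<lambda>q. word_prod G n q w) (ev_left G u (vbox_pow G p))"
  | "word_prod G 0 (Vect u # p) w = 0"
  | "word_prod G n (Elt e # p) w = 0"

definition tprod :: "('w::ring_1, 'e, 'm) connection_scheme \<Rightarrow>
    ('w, 'e) tensor \<Rightarrow> ('w, 'e) tensor \<Rightarrow> ('w, 'e) tensor" (infixl "\<bullet>\<index>" 70) where
  "v \<bullet>\<^bsub>G\<^esub> w = frag_extend (\<lambda>p. word_prod G (vec_degree p) p w) v"

text \<open>Nested evaluation \<open>ev\<^sup>\<langle>\<^sup>n\<^sup>\<rangle>\<close> of a word of vector fields (possibly with scalar letters) on a word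
  of 1-forms.\<close>

fun ev_nested :: "('w::ring_1, 'e) letter list \<Rightarrow> ('w, 'e) letter list \<Rightarrow> 'w" where
    "ev_nested [] ws = 1"
  | "ev_nested (Form a # p) ws = a * ev_nested p ws"
  | "ev_nested (Vect v # p) ws = v (ev_nested p (butlast ws) * form (last ws))"
  | "ev_nested (Elt e # p) ws = 0"

text \<open>\<open>\<nabla>\<^sub>E\<^sup>(\<^sup>n\<^sup>) : E \<rightarrow> \<Omega>\<^sup>\<otimes>\<^sup>n A \<otimes>\<^sub>A E\<close>, started at \<open>n = 0\<close> with \<open>\<nabla>\<^sub>E\<^sup>(\<^sup>0\<^sup>) e = e\<close>; the recursion then
  gives \<open>\<nabla>\<^sub>E\<^sup>(\<^sup>1\<^sup>) = \<nabla>\<^sub>E\<close>.\<close>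

primrec nabla_pow :: "('w::ring_1, 'e, 'm) connection_scheme \<Rightarrow> nat \<Rightarrow> 'e \<Rightarrow> ('w, 'e) tensor" where
    "nabla_pow G 0 e = frag_of [Elt e]"
  | "nabla_pow G (Suc n) e = frag_extend
       (\<lambda>p. fbox_pow G n (butlast p) \<otimes> frag_of [last p]
            + frag_of (butlast p) \<otimes> nabla G (elt (last p))) (nabla_pow G n e)"

text \<open>\<open>p \<triangleright> e\<close> for a word \<open>p\<close> in \<open>\<T>Vec A\<close>; elements of \<open>E\<close> appear as combinations of one-letter words.\<close>

definition word_act :: "('w::ring_1, 'e, 'm) connection_scheme \<Rightarrow>
    ('w, 'e) letter list \<Rightarrow> 'e \<Rightarrow> ('w, 'e) tensor" where
  "word_act G p e = frag_extend
     (\<lambda>r. frag_of [Elt (smul G (ev_nested p (butlast r)) (elt (last r)))])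
     (nabla_pow G (vec_degree p) e)"

section \<open>Curvature\<close>

text \<open>\<open>R\<^sub>E = (d \<otimes> id - id \<and> \<nabla>\<^sub>E) \<nabla>\<^sub>E\<close>\<close>

definition curvature :: "('w::ring_1, 'e, 'm) connection_scheme \<Rightarrow> 'e \<Rightarrow> ('w, 'e) tensor" where
  "curvature G e = frag_extend
     (\<lambda>p. frag_of [Form (dif G (form (p ! 0))), p ! 1]
        - frag_extend (\<lambda>q. frag_of [Form (form (p ! 0) * form (q ! 0)), q ! 1])
            (nabla G (elt (p ! 1)))) (nabla G e)"

text \<open>The element \<open>\<R> \<in> \<Omega>\<^sup>2A \<otimes>\<^sub>A \<T>Vec A\<close>.\<close>

definition curvature_element :: "('w::ring_1, 'e, 'm) connection_scheme \<Rightarrow> ('w, 'e) tensor" where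
  "curvature_element G =
     (\<Sum>i<rank G. frag_of [Form (dif G (coframe G i)), Vect (frame G i)])
     - (\<Sum>i<rank G. \<Sum>j<rank G. frag_of [Form (coframe G i * coframe G j)]
          \<otimes> (frag_of [Vect (frame G j)] \<bullet>\<^bsub>G\<^esub> frag_of [Vect (frame G i)]))"

text \<open>\<open>(\<omega> \<otimes> v) \<triangleright> e = \<omega> \<otimes> (v \<triangleright> e)\<close>, extended additively.\<close>

definition form_act :: "('w::ring_1, 'e, 'm) connection_scheme \<Rightarrow>
    ('w, 'e) tensor \<Rightarrow> 'e \<Rightarrow> ('w, 'e) tensor" (infixr "\<triangleright>\<index>" 65) where
  "x \<triangleright>\<^bsub>G\<^esub> e = frag_extend (\<lambda>p. frag_of [hd p] \<otimes> word_act G (tl p) e) x"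

end

theory Submission
  imports Defs
begin

text \<open>
  For \<open>\<nabla>\<^sub>E e = \<eta> \<otimes> f\<close>, contracting the dual basis in the second-order part of \<open>\<R> \<triangleright> e\<close> produces
  \<open>\<eta> \<and> \<nabla>\<^sub>E f\<close>. In the remaining terms it turns the correction term of \<open>u\<^sub>j \<bullet> u\<^sub>i\<close> together with the
  term coming from \<open>\<box> \<eta>\<close> into \<open>\<Sum>\<^sub>i \<xi>\<^sub>i \<and> d(u\<^sub>i(\<eta>))\<close>, by duality of the two connections. Subtracted
  from \<open>\<Sum>\<^sub>i d\<xi>\<^sub>i u\<^sub>i(\<eta>)\<close> this gives \<open>d \<eta>\<close>, by the Leibniz rule for \<open>\<eta> = \<Sum>\<^sub>i \<xi>\<^sub>i u\<^sub>i(\<eta>)\<close>.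
\<close>

section \<open>Additive extension from words to formal sums\<close>

lemma frag_extend_frag_extend:
  "frag_extend f (frag_extend g x) = frag_extend (\<lambda>p. frag_extend f (g p)) x"
  by (induction x rule: frag_induction[OF subset_UNIV]) (auto simp: frag_extend_diff)

lemma frag_extend_add_fun:
  "frag_extend (\<lambda>p. f p + g p) x = frag_extend f x + frag_extend g x"
  by (induction x rule: frag_induction[OF subset_UNIV]) (auto simp: frag_extend_diff)

lemma frag_extend_diff_fun:
  "frag_extend (\<lambda>p. f p - g p) x = frag_extend f x - frag_extend g x"
  by (induction x rule: frag_induction[OF subset_UNIV]) (auto simp: frag_extend_diff)

lemma frag_extend_sum_fun:
  "frag_extend (\<lambda>p. \<Sum>i\<in>I. f i p) x = (\<Sum>i\<in>I. frag_extend (f i) x)"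
  by (induction x rule: frag_induction[OF subset_UNIV]) (auto simp: frag_extend_diff sum_subtractf)

text \<open>Interchange of two finite sums. It brings the expansion of \<open>nabla G e\<close> to
  the outside where the product \<bullet> expands \<open>vbox\<close> first.\<close>

lemma frag_extend_swap:
  "frag_extend (\<lambda>p. frag_extend (f p) y) x = frag_extend (\<lambda>q. frag_extend (\<lambda>p. f p q) x) y"
  by (induction x rule: frag_induction[OF subset_UNIV])
    (auto simp: frag_extend_diff frag_extend_diff_fun frag_extend_eq_0)

lemma frag_of_tmult: "frag_of p \<otimes> x = frag_extend (\<lambda>q. frag_of (p @ q)) x"
  by (simp add: tmult_def)

lemma frag_of_Nil_tmult [simp]: "frag_of [] \<otimes> x = x"
  by (simp add: frag_of_tmult frag_expansion[symmetric])

lemma tmult_frag_of_Nil [simp]: "x \<otimes> frag_of [] = x"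
  by (simp add: tmult_def frag_expansion[symmetric])

lemma zero_tmult [simp]: "0 \<otimes> x = 0"
  by (simp add: tmult_def)

text \<open>Counterpart of \<open>frag_extend\<close> with values in a ring, so that coefficients
  can be computed in the algebra of forms itself and compared by genuine equality.\<close>

definition frag_sum :: "('a \<Rightarrow> 'b::ring_1) \<Rightarrow> ('a \<Rightarrow>\<^sub>0 int) \<Rightarrow> 'b" where
  "frag_sum h x = (\<Sum>p\<in>Poly_Mapping.keys x. of_int (Poly_Mapping.lookup x p) * h p)"

lemma frag_sum_0 [simp]: "frag_sum h 0 = 0"
  by (simp add: frag_sum_def)

lemma frag_sum_frag_of [simp]: "frag_sum h (frag_of p) = h p"
  by (simp add: frag_sum_def)

lemma frag_sum_diff: "frag_sum h (x - y) = frag_sum h x - frag_sum h y"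
proof -
  let ?K = "Poly_Mapping.keys x \<union> Poly_Mapping.keys y"
  \<comment> \<open>Cancellation can make the keys of \<open>x - y\<close> smaller than the union,
    so all three sums are first taken over the common set \<open>?K\<close>.\<close>
  have *: "frag_sum h z = (\<Sum>p\<in>?K. of_int (Poly_Mapping.lookup z p) * h p)"
    if "Poly_Mapping.keys z \<subseteq> ?K" for z
    unfolding frag_sum_def by (rule sum.mono_neutral_left) (use that in \<open>auto simp: in_keys_iff\<close>)
  show ?thesis
    using keys_diff[of x y]
    by (simp add: * lookup_minus left_diff_distrib sum_subtractf)
qed

lemma frag_sum_add: "frag_sum h (x + y) = frag_sum h x + frag_sum h y"
  using frag_sum_diff[of h "x + y" y] by simp

lemma frag_sum_cong:
  "(\<And>p. p \<in> Poly_Mapping.keys x \<Longrightarrow> h p = k p) \<Longrightarrow> frag_sum h x = frag_sum k x"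
  by (simp add: frag_sum_def)

lemma frag_sum_frag_extend: "frag_sum h (frag_extend f x) = frag_sum (\<lambda>p. frag_sum h (f p)) x"
  by (induction x rule: frag_induction[OF subset_UNIV])
    (auto simp: frag_extend_diff frag_sum_diff)

lemma frag_sum_mult_left: "frag_sum (\<lambda>p. c * h p) x = c * frag_sum h x"
  by (induction x rule: frag_induction[OF subset_UNIV]) (auto simp: frag_sum_diff right_diff_distrib)

lemma frag_sum_sum_fun: "frag_sum (\<lambda>p. \<Sum>i\<in>I. h i p) x = (\<Sum>i\<in>I. frag_sum (h i) x)"
  by (induction x rule: frag_induction[OF subset_UNIV]) (auto simp: frag_sum_diff sum_subtractf)

section \<open>The congruence on tensors\<close>

lemma teq_refl: "x \<approx>\<^bsub>G\<^esub> x"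
  by (simp add: teq_def tensor_relations.zero)

lemma teq_diff: "\<lbrakk>x \<approx>\<^bsub>G\<^esub> x'; y \<approx>\<^bsub>G\<^esub> y'\<rbrakk> \<Longrightarrow> x - y \<approx>\<^bsub>G\<^esub> x' - y'"
  unfolding teq_def using tensor_relations.minus[of "x - x'" G "y - y'"]
  by (simp add: algebra_simps)

lemma teq_sym: "x \<approx>\<^bsub>G\<^esub> y \<Longrightarrow> y \<approx>\<^bsub>G\<^esub> x"
  unfolding teq_def using tensor_relations.minus[OF tensor_relations.zero, where y = "x - y"] by simp

lemma teq_add: "\<lbrakk>x \<approx>\<^bsub>G\<^esub> x'; y \<approx>\<^bsub>G\<^esub> y'\<rbrakk> \<Longrightarrow> x + y \<approx>\<^bsub>G\<^esub> x' + y'"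
  unfolding teq_def
  using tensor_relations.minus[of "x - x'" G "y' - y"] teq_sym[of G y y', unfolded teq_def]
  by (simp add: algebra_simps)

lemma teq_trans: "\<lbrakk>x \<approx>\<^bsub>G\<^esub> y; y \<approx>\<^bsub>G\<^esub> z\<rbrakk> \<Longrightarrow> x \<approx>\<^bsub>G\<^esub> z"
  using teq_add[of G x y y z] by (simp add: teq_def)

lemma teq_sum: "(\<And>i. i \<in> I \<Longrightarrow> f i \<approx>\<^bsub>G\<^esub> g i) \<Longrightarrow> (\<Sum>i\<in>I. f i) \<approx>\<^bsub>G\<^esub> (\<Sum>i\<in>I. g i)"
  by (induction I rule: infinite_finite_induct) (auto intro: teq_add teq_refl)

text \<open>Only words that occur in \<open>x\<close> are compared. This matters because the maps on
  words take meaningless values on words of the wrong shape.\<close>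

lemma teq_frag_extend:
  assumes "\<And>p. p \<in> Poly_Mapping.keys x \<Longrightarrow> f p \<approx>\<^bsub>G\<^esub> g p"
  shows "frag_extend f x \<approx>\<^bsub>G\<^esub> frag_extend g x"
  by (rule frag_induction[where c = x, OF subset_refl]) (auto simp: frag_extend_diff assms intro: teq_diff teq_refl)

text \<open>Multiplying out words of forms respects \<open>\<approx>\<close>, so it recovers equality in \<open>\<Omega>A\<close> from equality of tensors.\<close>

primrec form_prod :: "('w::ring_1, 'e) letter list \<Rightarrow> 'w" where
    "form_prod [] = 1"
  | "form_prod (x # p) = (case x of Form w \<Rightarrow> w * form_prod p | _ \<Rightarrow> 0)"

lemma form_prod_append: "form_prod (p @ q) = form_prod p * form_prod q"
  by (induction p) (auto simp: mult.assoc split: letter.split)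

text \<open>Balancing and absorption become associativity, and additivity becomes distributivity. A
  word with a vector or module letter has product 0, and the relations preserve the kind of such
  letters.\<close>

lemma frag_sum_form_prod_relations:
  "x \<in> tensor_relations G \<Longrightarrow> frag_sum form_prod x = 0"
proof (induction rule: tensor_relations.induct)
  case (balanced x a y p q)
  then show ?case
    by (cases x; cases y)
      (auto simp: frag_sum_diff form_prod_append mult.assoc)
next
  case (absorb_left a y p q)
  then show ?case
    by (cases y) (auto simp: frag_sum_diff form_prod_append mult.assoc)
next
  case (absorb_right x a p q)
  then show ?case
    by (cases x) (auto simp: frag_sum_diff form_prod_append mult.assoc)
qed (auto simp: frag_sum_diff form_prod_append distrib_left distrib_right)

lemma teq_frag_sum_form_prod: "x \<approx>\<^bsub>G\<^esub> y \<Longrightarrow> frag_sum form_prod x = frag_sum form_prod y"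
  using frag_sum_form_prod_relations[of "x - y" G] by (simp add: teq_def frag_sum_diff)

section \<open>Degrees in the graded algebra\<close>

lemma Vec_in: "\<lbrakk>v \<in> Vec G; \<xi> \<in> Omega G 1\<rbrakk> \<Longrightarrow> v \<xi> \<in> Omega G 0"
  by (simp add: Vec_def)

context dg_algebra
begin

lemma Omega_zero: "0 \<in> Omega G n"
  using module.subspace_0[OF _ Omega_subspace] vector_space
  by (simp add: vector_space_def module_iff_vector_space)

lemma Omega_add: "\<lbrakk>x \<in> Omega G n; y \<in> Omega G n\<rbrakk> \<Longrightarrow> x + y \<in> Omega G n"
  using module.subspace_add[OF _ Omega_subspace] vector_space
  by (simp add: module_iff_vector_space)

lemma Omega_diff: "\<lbrakk>x \<in> Omega G n; y \<in> Omega G n\<rbrakk> \<Longrightarrow> x - y \<in> Omega G n"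
  using module.subspace_diff[OF _ Omega_subspace] vector_space
  by (simp add: module_iff_vector_space)

lemma Omega_sum: "(\<And>i. i \<in> I \<Longrightarrow> f i \<in> Omega G n) \<Longrightarrow> (\<Sum>i\<in>I. f i) \<in> Omega G n"
  by (induction I rule: infinite_finite_induct) (auto intro: Omega_zero Omega_add)

lemma Omega_mult_0_right: "\<lbrakk>x \<in> Omega G n; a \<in> Omega G 0\<rbrakk> \<Longrightarrow> x * a \<in> Omega G n"
  using Omega_mult[of x n a 0] by simp

lemma Omega_mult_0_left: "\<lbrakk>a \<in> Omega G 0; x \<in> Omega G n\<rbrakk> \<Longrightarrow> a * x \<in> Omega G n"
  using Omega_mult[of a 0 x n] by simp

lemma Omega_mult_1_1: "\<lbrakk>x \<in> Omega G 1; y \<in> Omega G 1\<rbrakk> \<Longrightarrow> x * y \<in> Omega G 2"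
  using Omega_mult[of x 1 y 1] by (simp add: numeral_2_eq_2)

lemma frag_sum_in_Omega:
  assumes "\<And>p. p \<in> Poly_Mapping.keys x \<Longrightarrow> h p \<in> Omega G n"
  shows "frag_sum h x \<in> Omega G n"
  by (rule frag_induction[where c = x, OF subset_refl])
    (auto simp: frag_sum_diff assms intro: Omega_diff Omega_zero)

lemma dif_sum: "dif G (\<Sum>i\<in>I. f i) = (\<Sum>i\<in>I. dif G (f i))"
proof -
  interpret dif: Vector_Spaces.linear "cscale G" "cscale G" "dif G"
    by (rule dif_linear)
  show ?thesis by (rule dif.sum)
qed

end

section \<open>Collecting scalars in the form letter\<close>

context left_module
begin

lemma teq_form_smul:
  "\<lbrakk>\<omega> \<in> Omega G n; a \<in> Omega G 0\<rbrakk> \<Longrightarrow> frag_of [Form \<omega>, Elt (smul G a f)] \<approx>\<^bsub>G\<^esub> frag_of [Form (\<omega> * a), Elt f]"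
  using tensor_relations.balanced[of "Form \<omega>" G a "Elt f" "[]" "[]"]
    teq_sym[of G "frag_of [Form (\<omega> * a), Elt f]" "frag_of [Form \<omega>, Elt (smul G a f)]"]
  by (auto simp: teq_def bimodule_letters_def forms_def elts_def)

lemma teq_form_add:
  "\<lbrakk>x \<in> Omega G n; y \<in> Omega G n\<rbrakk> \<Longrightarrow>
    frag_of (Form (x + y) # p) \<approx>\<^bsub>G\<^esub> frag_of (Form x # p) + frag_of (Form y # p)"
  using tensor_relations.add_form[of x G n y "[]" p] by (simp add: teq_def algebra_simps)

lemma teq_form_diff:
  assumes "x \<in> Omega G n" "y \<in> Omega G n"
  shows "frag_of (Form (x - y) # p) \<approx>\<^bsub>G\<^esub> frag_of (Form x # p) - frag_of (Form y # p)"
  using teq_diff[OF teq_sym[OF teq_form_add[OF Omega_diff[OF assms] assms(2), of p]]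
      teq_refl[where x = "frag_of (Form y # p)"]]
  by simp

text \<open>A word with letter 0 is a nonzero generator of the formal sums, so its vanishing has to
  be derived from additivity. It is the base case of the inductions below.\<close>

lemma teq_form_zero: "frag_of (Form 0 # p) \<approx>\<^bsub>G\<^esub> 0"
  using teq_form_diff[OF Omega_zero Omega_zero] by simp

lemma teq_form_sum:
  assumes "\<And>i. i \<in> I \<Longrightarrow> f i \<in> Omega G n"
  shows "frag_of (Form (\<Sum>i\<in>I. f i) # p) \<approx>\<^bsub>G\<^esub> (\<Sum>i\<in>I. frag_of (Form (f i) # p))"
  using assms
proof (induction I rule: infinite_finite_induct)
  case (insert i I)
  then show ?case
    using teq_trans[OF teq_form_add[OF _ Omega_sum] teq_add[OF teq_refl]]
    by (smt (verit, best) insert_iff sum.insert)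
qed (auto intro: teq_form_zero)

lemma teq_form_frag_sum:
  assumes "\<And>p. p \<in> Poly_Mapping.keys x \<Longrightarrow> h p \<in> Omega G n"
  shows "frag_extend (\<lambda>p. frag_of (Form (h p) # q)) x \<approx>\<^bsub>G\<^esub> frag_of (Form (frag_sum h x) # q)"
proof -
  \<comment> \<open>Membership is carried through the induction together with the congruence, since
    additivity in a form letter is available only for forms of one common degree.\<close>
  have "frag_sum h x \<in> Omega G n \<and>
    frag_extend (\<lambda>p. frag_of (Form (h p) # q)) x \<approx>\<^bsub>G\<^esub> frag_of (Form (frag_sum h x) # q)"
  proof (rule frag_induction[where c = x, OF subset_refl])
    fix a b
    assume "frag_sum h a \<in> Omega G n \<and>
      frag_extend (\<lambda>p. frag_of (Form (h p) # q)) a \<approx>\<^bsub>G\<^esub> frag_of (Form (frag_sum h a) # q)"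
    and "frag_sum h b \<in> Omega G n \<and>
      frag_extend (\<lambda>p. frag_of (Form (h p) # q)) b \<approx>\<^bsub>G\<^esub> frag_of (Form (frag_sum h b) # q)"
    then show "frag_sum h (a - b) \<in> Omega G n \<and>
      frag_extend (\<lambda>p. frag_of (Form (h p) # q)) (a - b) \<approx>\<^bsub>G\<^esub> frag_of (Form (frag_sum h (a - b)) # q)"
      by (auto simp: frag_sum_diff frag_extend_diff
          intro: Omega_diff teq_trans[OF teq_diff teq_sym[OF teq_form_diff]])
  qed (auto simp: assms Omega_zero teq_refl teq_sym[OF teq_form_zero])
  then show ?thesis ..
qed

text \<open>Each scalar acting on the fixed element \<open>f\<close> crosses the tensor sign into
  the form, after which the form letters add up to a single word.\<close>

lemma teq_form_smul_frag_sum: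
  assumes "\<omega> \<in> Omega G n" "\<And>p. p \<in> Poly_Mapping.keys x \<Longrightarrow> h p \<in> Omega G 0"
  shows "frag_extend (\<lambda>p. frag_of [Form \<omega>, Elt (smul G (h p) f)]) x
    \<approx>\<^bsub>G\<^esub> frag_of [Form (frag_sum (\<lambda>p. \<omega> * h p) x), Elt f]"
  by (rule teq_trans[OF teq_frag_extend[OF teq_form_smul] teq_form_frag_sum])
    (auto intro: assms Omega_mult_0_right)

end

section \<open>Dual basis, duality of the connections and the Leibniz rule\<close>

lemma in_tensors_2:
  "\<lbrakk>x \<in> tensors [M, N]; p \<in> Poly_Mapping.keys x\<rbrakk> \<Longrightarrow> \<exists>a\<in>M. \<exists>b\<in>N. p = [a, b]"
  by (auto simp: tensors_def set_Cons_def)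

context left_connection
begin

lemma keys_nabla:
  assumes "p \<in> Poly_Mapping.keys (nabla G e)"
  obtains \<eta> f where "\<eta> \<in> Omega G 1" "p = [Form \<eta>, Elt f]"
  using in_tensors_2[OF nabla_in assms] by (auto simp: forms_def elts_def)

lemma keys_fbox:
  assumes "\<xi> \<in> Omega G 1" "p \<in> Poly_Mapping.keys (fbox G \<xi>)"
  obtains \<alpha> \<beta> where "\<alpha> \<in> Omega G 1" "\<beta> \<in> Omega G 1" "p = [Form \<alpha>, Form \<beta>]"
  using in_tensors_2[OF fbox_in assms(2)] assms(1) by (auto simp: forms_def)

lemma keys_vbox:
  assumes "u \<in> Vec G" "p \<in> Poly_Mapping.keys (vbox G u)"
  obtains \<omega> v where "\<omega> \<in> Omega G 1" "v \<in> Vec G" "p = [Form \<omega>, Vect v]"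
  using in_tensors_2[OF vbox_in assms(2)] assms(1) by (auto simp: forms_def vecs_def)

text \<open>The duality condition is given only up to congruence. Both of its sides multiply out by
  \<open>form_prod\<close> to forms, which turns it into an equation between forms.\<close>

lemma dif_Vec:
  assumes u: "u \<in> Vec G" and \<xi>: "\<xi> \<in> Omega G 1"
  shows "dif G (u \<xi>) = frag_sum (\<lambda>p. form (p ! 0) * vect (p ! 1) \<xi>) (vbox G u)
    + frag_sum (\<lambda>p. u (form (p ! 0)) * form (p ! 1)) (fbox G \<xi>)"
proof -
  have "frag_sum (\<lambda>p. form_prod (lmul_word G (u (form (hd p))) (tl p))) (fbox G \<xi>)
      = frag_sum (\<lambda>p. u (form (p ! 0)) * form (p ! 1)) (fbox G \<xi>)"
    by (rule frag_sum_cong) (auto elim: keys_fbox[OF \<xi>])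
  then show ?thesis
    using teq_frag_sum_form_prod[OF vbox_dual[OF u \<xi>]]
    by (simp add: frag_sum_add ev_left_def frag_sum_frag_extend)
qed

text \<open>The sum over \<open>j\<close> expands the 1-form
  \<open>frame G i \<eta> * \<zeta>\<close> in the dual basis; the sum over \<open>i\<close> then
  expands \<eta>.\<close>

lemma dual_basis_contract:
  assumes "\<eta> \<in> Omega G 1" "\<zeta> \<in> Omega G 1"
  shows "(\<Sum>i<rank G. \<Sum>j<rank G. coframe G i * coframe G j * frame G j (frame G i \<eta> * \<zeta>)) = \<eta> * \<zeta>"
proof -
  have "(\<Sum>j<rank G. coframe G i * coframe G j * frame G j (frame G i \<eta> * \<zeta>))
      = coframe G i * frame G i \<eta> * \<zeta>" if "i < rank G" for i
    using dual_basis[OF Omega_mult_0_left[OF Vec_in[OF frame_in[OF that] assms(1)] assms(2)]]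
    by (simp add: mult.assoc flip: sum_distrib_left)
  then show ?thesis
    using dual_basis[OF assms(1)] by (simp flip: sum_distrib_right)
qed

text \<open>For fixed \<open>i\<close>, contracting over \<open>j\<close> leaves the two halves of
  the duality formula for d(u_i(\<eta>)), multiplied by xi_i. The Leibniz rule applied to the dual
  basis expansion of \<eta> does the rest.\<close>

lemma dif_form:
  assumes \<eta>: "\<eta> \<in> Omega G 1"
  shows "dif G \<eta> = (\<Sum>i<rank G. dif G (coframe G i) * frame G i \<eta>)
    - (\<Sum>i<rank G. \<Sum>j<rank G.
        frag_sum (\<lambda>p. coframe G i * coframe G j * frame G j (frame G i (form (p ! 0)) * form (p ! 1)))
          (fbox G \<eta>)
      + frag_sum (\<lambda>p. coframe G i * coframe G j * (frame G j (form (p ! 0)) * vect (p ! 1) \<eta>))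
          (vbox G (frame G i)))"
proof -
  have *: "(\<Sum>j<rank G.
        frag_sum (\<lambda>p. coframe G i * coframe G j * frame G j (frame G i (form (p ! 0)) * form (p ! 1)))
          (fbox G \<eta>)
      + frag_sum (\<lambda>p. coframe G i * coframe G j * (frame G j (form (p ! 0)) * vect (p ! 1) \<eta>))
          (vbox G (frame G i))) = coframe G i * dif G (frame G i \<eta>)" if i: "i < rank G" for i
  proof -
    \<comment> \<open>Here the dual basis expands the whole 1-form u_i(\<alpha>) \<beta>.\<close>
    have B: "(\<Sum>j<rank G. coframe G i * coframe G j * frame G j (frame G i (form (p ! 0)) * form (p ! 1)))
        = coframe G i * (frame G i (form (p ! 0)) * form (p ! 1))"
      if "p \<in> Poly_Mapping.keys (fbox G \<eta>)" for p
    proof (rule keys_fbox[OF \<eta> that])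
      fix \<alpha> \<beta>
      assume "\<alpha> \<in> Omega G 1" "\<beta> \<in> Omega G 1" and p: "p = [Form \<alpha>, Form \<beta>]"
      then show ?thesis
        using dual_basis[OF Omega_mult_0_left[OF Vec_in[OF frame_in[OF i]]], of \<alpha> \<beta>]
        by (simp add: mult.assoc flip: sum_distrib_left)
    qed
    \<comment> \<open>Here it expands only the form letter \<omega>; the scalar
      \<open>v \<eta>\<close> stays as a factor on the right.\<close>
    have V: "(\<Sum>j<rank G. coframe G i * coframe G j * (frame G j (form (p ! 0)) * vect (p ! 1) \<eta>))
        = coframe G i * (form (p ! 0) * vect (p ! 1) \<eta>)"
      if "p \<in> Poly_Mapping.keys (vbox G (frame G i))" for p
    proof (rule keys_vbox[OF frame_in[OF i] that])
      fix \<omega> v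
      assume \<omega>: "\<omega> \<in> Omega G 1" and p: "p = [Form \<omega>, Vect v]"
      have "(\<Sum>j<rank G. coframe G i * coframe G j * (frame G j \<omega> * v \<eta>))
          = coframe G i * ((\<Sum>j<rank G. coframe G j * frame G j \<omega>) * v \<eta>)"
        by (simp add: sum_distrib_left sum_distrib_right mult.assoc)
      then show ?thesis
        using dual_basis[OF \<omega>] p by simp
    qed
    show ?thesis
      unfolding sum.distrib frag_sum_sum_fun[symmetric] dif_Vec[OF frame_in[OF i] \<eta>] distrib_left
      by (simp only: B V frag_sum_mult_left add.commute cong: frag_sum_cong)
  qed
  have "dif G \<eta> = (\<Sum>i<rank G. dif G (coframe G i * frame G i \<eta>))"
    using dual_basis[OF \<eta>] dif_sum by metis
  \<comment> \<open>The minus sign is the Leibniz sign for a form of degree 1.\<close>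
  also have "\<dots> = (\<Sum>i<rank G. dif G (coframe G i) * frame G i \<eta> - coframe G i * dif G (frame G i \<eta>))"
    by (intro sum.cong refl) (simp add: dif_leibniz[OF coframe_in])
  finally show ?thesis
    by (simp add: sum_subtractf * del: One_nat_def)
qed

section \<open>Action of products of at most two vector fields\<close>

lemma nabla_pow_1: "nabla_pow G (Suc 0) e = nabla G e"
  by simp

lemma word_act_1:
  "word_act G [Vect u] e
    = frag_extend (\<lambda>r. frag_of [Elt (smul G (u (form (r ! 0))) (elt (r ! 1)))]) (nabla G e)"
proof -
  have "vec_degree [Vect u :: ('w, 'e) letter] = Suc 0"
    by (simp add: vec_degree_def)
  then show ?thesis
    unfolding word_act_def
    by (simp only: nabla_pow_1) (rule frag_extend_eq, auto elim: keys_nabla)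
qed

text \<open>The two summands differentiate the form letter and the module letter of
  \<open>nabla G e\<close>. No \<open>sinv\<close> term survives, because
  \<open>fbox_pow G 0\<close> is 0. By nesting, \<open>v\<close> meets the first form and
  \<open>u\<close> the second.\<close>

lemma word_act_2:
  "word_act G [Vect u, Vect v] e = frag_extend (\<lambda>r.
      frag_extend (\<lambda>s. frag_of [Elt (smul G (u (v (form (s ! 0)) * form (s ! 1))) (elt (r ! 1)))])
        (fbox G (form (r ! 0)))
      + frag_extend (\<lambda>s. frag_of [Elt (smul G (u (v (form (r ! 0)) * form (s ! 0))) (elt (s ! 1)))])
        (nabla G (elt (r ! 1)))) (nabla G e)"
proof -
  have deg: "vec_degree [Vect u, Vect v :: ('w, 'e) letter] = Suc (Suc 0)"
    by (simp add: vec_degree_def)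
  show ?thesis
    unfolding word_act_def deg nabla_pow.simps(2)[of G "Suc 0"] nabla_pow_1 frag_extend_frag_extend
  proof (rule frag_extend_eq)
    fix r
    assume "r \<in> Poly_Mapping.keys (nabla G e)"
    then obtain \<eta> f where \<eta>: "\<eta> \<in> Omega G 1" and r: "r = [Form \<eta>, Elt f]"
      by (rule keys_nabla)
    show "frag_extend (\<lambda>r. frag_of [Elt (smul G (ev_nested [Vect u, Vect v] (butlast r)) (elt (last r)))])
        (fbox_pow G (Suc 0) (butlast r) \<otimes> frag_of [last r]
          + frag_of (butlast r) \<otimes> nabla G (elt (last r)))
      = frag_extend (\<lambda>s. frag_of [Elt (smul G (u (v (form (s ! 0)) * form (s ! 1))) (elt (r ! 1)))])
        (fbox G (form (r ! 0)))
      + frag_extend (\<lambda>s. frag_of [Elt (smul G (u (v (form (r ! 0)) * form (s ! 0))) (elt (s ! 1)))])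
        (nabla G (elt (r ! 1)))"
      by (auto simp: r frag_extend_add tmult_def frag_extend_frag_extend
          intro!: arg_cong2[of _ _ _ _ "(+)"] frag_extend_eq elim: keys_fbox[OF \<eta>] keys_nabla)
  qed
qed

text \<open>Both the \<open>sigma\<close> term and the subtracted term of the recursion vanish,
  because \<open>vbox_pow G []\<close> is 0.\<close>

lemma tprod_vect_vect:
  "frag_of [Vect u] \<bullet>\<^bsub>G\<^esub> frag_of [Vect v] = frag_of [Vect u, Vect v] + ev_left G u (vbox G v)"
  by (simp add: tprod_def vec_degree_def vprod_def ev_left_def tmult_def frag_expansion[symmetric])

lemma form_act_tmult:
  "(frag_of [Form \<omega>] \<otimes> x) \<triangleright>\<^bsub>G\<^esub> e = frag_extend (\<lambda>p. frag_of [Form \<omega>] \<otimes> word_act G p e) x"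
  by (simp add: form_act_def frag_of_tmult frag_extend_frag_extend)

lemma form_act_1:
  "frag_of [Form \<omega>, Vect u] \<triangleright>\<^bsub>G\<^esub> e
    = frag_extend (\<lambda>r. frag_of [Form \<omega>, Elt (smul G (u (form (r ! 0))) (elt (r ! 1)))]) (nabla G e)"
  by (simp add: form_act_def word_act_1 frag_of_tmult frag_extend_frag_extend)

text \<open>The first two summands are the second-order action of the word
  \<open>[Vect u, Vect v]\<close>, the third is the first-order action of the correction term in the
  product. The assumption on \<open>v\<close> fixes the shape of the words in
  \<open>vbox G v\<close>.\<close>

lemma form_act_tprod:
  assumes v: "v \<in> Vec G"
  shows "(frag_of [Form \<omega>] \<otimes> (frag_of [Vect u] \<bullet>\<^bsub>G\<^esub> frag_of [Vect v])) \<triangleright>\<^bsub>G\<^esub> e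
    = frag_extend (\<lambda>r.
        frag_extend (\<lambda>s. frag_of [Form \<omega>, Elt (smul G (u (v (form (s ! 0)) * form (s ! 1))) (elt (r ! 1)))])
          (fbox G (form (r ! 0)))
        + frag_extend (\<lambda>s. frag_of [Form \<omega>, Elt (smul G (u (v (form (r ! 0)) * form (s ! 0))) (elt (s ! 1)))])
          (nabla G (elt (r ! 1)))
        + frag_extend (\<lambda>s. frag_of
            [Form \<omega>, Elt (smul G (u (form (s ! 0)) * vect (s ! 1) (form (r ! 0))) (elt (r ! 1)))])
          (vbox G v)) (nabla G e)"
proof -
  have "frag_extend (\<lambda>s. frag_of [Form \<omega>] \<otimes> word_act G (lmul_word G (u (form (hd s))) (tl s)) e) (vbox G v)
    = frag_extend (\<lambda>s. frag_extend (\<lambda>r. frag_of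
        [Form \<omega>, Elt (smul G (u (form (s ! 0)) * vect (s ! 1) (form (r ! 0))) (elt (r ! 1)))])
        (nabla G e)) (vbox G v)"
    by (rule frag_extend_eq)
      (auto simp: word_act_1 frag_of_tmult frag_extend_frag_extend elim: keys_vbox[OF v])
  then show ?thesis
    unfolding form_act_tmult tprod_vect_vect frag_extend_add ev_left_def frag_extend_frag_extend
      frag_extend_of word_act_2
    by (simp add: frag_of_tmult frag_extend_frag_extend frag_extend_add frag_extend_add_fun
        frag_extend_swap[of _ "nabla G e" "vbox G v"])
qed

section \<open>Comparison with the curvature\<close>

text \<open>This is the claim for a single word \<eta> \<otimes> f of \<open>nabla G e\<close>. The
  terms \<open>?D\<close>, \<open>?B\<close> and \<open>?V\<close> keep the letter \<open>f\<close>
  and combine to d\<eta> by \<open>dif_form\<close>; the terms \<open>?C\<close> give the wedge with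
  \<open>nabla G f\<close>.\<close>

lemma curvature_integrand:
  assumes \<eta>: "\<eta> \<in> Omega G 1"
  shows "(\<Sum>i<rank G. frag_of [Form (dif G (coframe G i)), Elt (smul G (frame G i \<eta>) f)])
    - (\<Sum>i<rank G. \<Sum>j<rank G.
        frag_extend (\<lambda>s. frag_of [Form (coframe G i * coframe G j),
            Elt (smul G (frame G j (frame G i (form (s ! 0)) * form (s ! 1))) f)]) (fbox G \<eta>)
        + frag_extend (\<lambda>s. frag_of [Form (coframe G i * coframe G j),
            Elt (smul G (frame G j (frame G i \<eta> * form (s ! 0))) (elt (s ! 1)))]) (nabla G f)
        + frag_extend (\<lambda>s. frag_of [Form (coframe G i * coframe G j),
            Elt (smul G (frame G j (form (s ! 0)) * vect (s ! 1) \<eta>) f)]) (vbox G (frame G i)))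
    \<approx>\<^bsub>G\<^esub> frag_of [Form (dif G \<eta>), Elt f]
      - frag_extend (\<lambda>q. frag_of [Form (\<eta> * form (q ! 0)), q ! 1]) (nabla G f)"
    (is "?D - (\<Sum>i<_. \<Sum>j<_. ?B i j + ?C i j + ?V i j) \<approx>\<^bsub>G\<^esub> _ - ?N")
proof -
  let ?n = "rank G"
  define b where "b i j s = coframe G i * coframe G j
    * frame G j (frame G i (form (s ! 0)) * form (s ! 1))" for i j and s :: "('w, 'e) letter list"
  define v where "v i j s = coframe G i * coframe G j
    * (frame G j (form (s ! 0)) * vect (s ! 1) \<eta>)" for i j and s :: "('w, 'e) letter list"
  define d where "d i = dif G (coframe G i) * frame G i \<eta>" for i
  \<comment> \<open>These degree facts license every later addition in the first letter, all of
    which happen in degree 2.\<close>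
  have xx: "coframe G i * coframe G j \<in> Omega G 2" if "i < ?n" "j < ?n" for i j
    using that by (intro Omega_mult_1_1 coframe_in)
  have fr: "frame G i \<zeta> \<in> Omega G 0" if "i < ?n" "\<zeta> \<in> Omega G 1" for i \<zeta>
    using that by (intro Vec_in[OF frame_in])
  have dxi: "dif G (coframe G i) \<in> Omega G 2" if "i < ?n" for i
    using dif_degree[OF coframe_in[OF that]] by (simp add: numeral_2_eq_2)
  have d_in: "d i \<in> Omega G 2" if "i < ?n" for i
    unfolding d_def using that by (intro Omega_mult_0_right dxi fr \<eta>)
  have b_in: "b i j s \<in> Omega G 2"
    if "i < ?n" "j < ?n" "s \<in> Poly_Mapping.keys (fbox G \<eta>)" for i j s
    by (rule keys_fbox[OF \<eta> that(3)])
      (use that in \<open>auto simp: b_def intro: Omega_mult_0_right[OF xx fr[OF _ Omega_mult_0_left[OF fr]]]\<close>)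
  have v_in: "v i j s \<in> Omega G 2"
    if "i < ?n" "j < ?n" "s \<in> Poly_Mapping.keys (vbox G (frame G i))" for i j s
    by (rule keys_vbox[OF frame_in[OF that(1)] that(3)])
      (use that \<eta> in \<open>auto simp: v_def intro: Omega_mult_0_right[OF xx Omega_mult_0_right[OF fr Vec_in]]\<close>)
  have D: "?D \<approx>\<^bsub>G\<^esub> frag_of [Form (\<Sum>i<?n. d i), Elt f]"
    by (rule teq_trans[OF teq_sum teq_sym[OF teq_form_sum]])
      (auto simp: d_def intro!: teq_form_smul d_in[unfolded d_def] dxi fr \<eta>)
  have B: "?B i j \<approx>\<^bsub>G\<^esub> frag_of [Form (frag_sum (b i j) (fbox G \<eta>)), Elt f]"
    if "i < ?n" "j < ?n" for i j
    unfolding b_def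
    by (rule teq_form_smul_frag_sum[OF xx[OF that]], erule keys_fbox[OF \<eta>])
      (use that in \<open>auto intro: fr[OF _ Omega_mult_0_left[OF fr]]\<close>)
  have V: "?V i j \<approx>\<^bsub>G\<^esub> frag_of [Form (frag_sum (v i j) (vbox G (frame G i))), Elt f]"
    if "i < ?n" "j < ?n" for i j
    unfolding v_def
    by (rule teq_form_smul_frag_sum[OF xx[OF that]], erule keys_vbox[OF frame_in[OF that(1)]])
      (use that \<eta> in \<open>auto intro: Omega_mult_0_right[OF fr Vec_in]\<close>)
  have BV: "(\<Sum>i<?n. \<Sum>j<?n. ?B i j + ?V i j) \<approx>\<^bsub>G\<^esub> frag_of [Form (\<Sum>i<?n. \<Sum>j<?n.
      frag_sum (b i j) (fbox G \<eta>) + frag_sum (v i j) (vbox G (frame G i))), Elt f]"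
    by (intro teq_trans[OF teq_sum teq_sym[OF teq_form_sum]] teq_trans[OF teq_add teq_sym[OF teq_form_add]]
        Omega_sum Omega_add frag_sum_in_Omega B V) (auto intro: b_in v_in)
  \<comment> \<open>In \<open>?C\<close> the module letter varies with the word \<open>s\<close>, so
    the sums over \<open>i\<close> and \<open>j\<close> are moved inside and contracted separately
    for each word of \<open>nabla G f\<close>.\<close>
  have "(\<Sum>i<?n. \<Sum>j<?n. ?C i j) = frag_extend (\<lambda>s. \<Sum>i<?n. \<Sum>j<?n. frag_of [Form (coframe G i * coframe G j),
            Elt (smul G (frame G j (frame G i \<eta> * form (s ! 0))) (elt (s ! 1)))]) (nabla G f)"
    by (simp add: frag_extend_sum_fun)
  also have "\<dots> \<approx>\<^bsub>G\<^esub> ?N"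
  proof (rule teq_frag_extend)
    fix s
    assume "s \<in> Poly_Mapping.keys (nabla G f)"
    then obtain \<zeta> g where \<zeta>: "\<zeta> \<in> Omega G 1" and s: "s = [Form \<zeta>, Elt g]"
      by (rule keys_nabla)
    have "(\<Sum>i<?n. \<Sum>j<?n. frag_of [Form (coframe G i * coframe G j),
        Elt (smul G (frame G j (frame G i \<eta> * \<zeta>)) g)])
      \<approx>\<^bsub>G\<^esub> frag_of [Form (\<Sum>i<?n. \<Sum>j<?n. coframe G i * coframe G j * frame G j (frame G i \<eta> * \<zeta>)), Elt g]"
      by (intro teq_trans[OF teq_sum teq_sym[OF teq_form_sum]] teq_form_smul Omega_sum)
        (auto intro: xx Omega_mult_0_right[OF xx fr] fr[OF _ Omega_mult_0_left[OF fr[OF _ \<eta>] \<zeta>]]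
          Omega_mult_0_left[OF fr[OF _ \<eta>] \<zeta>])
    then show "(\<Sum>i<?n. \<Sum>j<?n. frag_of [Form (coframe G i * coframe G j),
            Elt (smul G (frame G j (frame G i \<eta> * form (s ! 0))) (elt (s ! 1)))])
          \<approx>\<^bsub>G\<^esub> frag_of [Form (\<eta> * form (s ! 0)), s ! 1]"
      by (simp add: s dual_basis_contract[OF \<eta> \<zeta>])
  qed
  finally have C: "(\<Sum>i<?n. \<Sum>j<?n. ?C i j) \<approx>\<^bsub>G\<^esub> ?N" .
  have "frag_of [Form (\<Sum>i<?n. d i), Elt f] - frag_of [Form (\<Sum>i<?n. \<Sum>j<?n.
      frag_sum (b i j) (fbox G \<eta>) + frag_sum (v i j) (vbox G (frame G i))), Elt f]
    \<approx>\<^bsub>G\<^esub> frag_of [Form (dif G \<eta>), Elt f]"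
    unfolding dif_form[OF \<eta>] b_def[symmetric] v_def[symmetric] d_def[symmetric]
    by (intro teq_sym[OF teq_form_diff] Omega_sum Omega_add frag_sum_in_Omega)
      (auto intro: b_in v_in d_in)
  with teq_diff[OF D BV] have "?D - (\<Sum>i<?n. \<Sum>j<?n. ?B i j + ?V i j) \<approx>\<^bsub>G\<^esub> frag_of [Form (dif G \<eta>), Elt f]"
    by (rule teq_trans)
  moreover have "(\<Sum>i<?n. \<Sum>j<?n. ?B i j + ?C i j + ?V i j)
      = (\<Sum>i<?n. \<Sum>j<?n. ?B i j + ?V i j) + (\<Sum>i<?n. \<Sum>j<?n. ?C i j)"
    by (simp only: sum.distrib ac_simps)
  ultimately show ?thesis
    using teq_diff[OF _ C] by (simp only: diff_diff_eq[symmetric])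
qed

text \<open>Both sides are additive extensions over the words of the same representative
  \<open>nabla G e\<close>, so it suffices to compare them word by word.\<close>

lemma curvature_element_act: "curvature_element G \<triangleright>\<^bsub>G\<^esub> e \<approx>\<^bsub>G\<^esub> curvature G e"
proof -
  have "curvature_element G \<triangleright>\<^bsub>G\<^esub> e
    = (\<Sum>i<rank G. frag_of [Form (dif G (coframe G i)), Vect (frame G i)] \<triangleright>\<^bsub>G\<^esub> e)
      - (\<Sum>i<rank G. \<Sum>j<rank G. (frag_of [Form (coframe G i * coframe G j)]
          \<otimes> (frag_of [Vect (frame G j)] \<bullet>\<^bsub>G\<^esub> frag_of [Vect (frame G i)])) \<triangleright>\<^bsub>G\<^esub> e)"
    by (simp add: curvature_element_def form_act_def frag_extend_diff frag_extend_sum o_def)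
  also have "\<dots> \<approx>\<^bsub>G\<^esub> curvature G e"
    unfolding curvature_def form_act_1
    \<comment> \<open>The rewriting goes under both sums by congruence, because
      \<open>form_act_tprod\<close> needs u_i in Vec A and hence the bound on
      \<open>i\<close>.\<close>
    by (subst sum.cong[OF refl sum.cong[OF refl form_act_tprod[OF frame_in]]], simp,
        unfold frag_extend_sum_fun[symmetric] frag_extend_diff_fun[symmetric],
        rule teq_frag_extend, erule keys_nabla)
      (simp only: nth_Cons_0 letter.sel nth_Cons_Suc One_nat_def curvature_integrand[unfolded One_nat_def])
  finally show ?thesis .
qed

end

theorem proposition4p1:
  fixes G :: "('w::ring_1, 'e::ab_group_add) connection" and e :: 'e
  assumes "left_connection G"
  shows "curvature_element G \<triangleright>\<^bsub>G\<^esub> e \<approx>\<^bsub>G\<^esub> curvature G e"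
  using assms by (rule left_connection.curvature_element_act)

end
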